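(* For every finite simple graph $G$, $M(G)\leq \Delta^+(G)$.
   Context: Graphs are finite and simple. For a real symmetric $n\times n$ matrix $A=[a_{ij}]$, the graph of $A$ is the simple graph on vertices $1,\ldots,n$ where $\{i,j\}$ ($i\neq j$) is an edge if and only if $a_{ij}\neq 0$ (the diagonal entries are unrestricted). For a graph $G$ on $n$ vertices, $S(G)$ is the set of all $n\times n$ real symmetric matrices whose graph is $G$, and $M(G)$ is the maximum multiplicity of an eigenvalue of a matrix in $S(G)$; equivalently $M(G)=\max_{A\in S(G)}\operatorname{nullity}(A)$. $\Delta^+(G)$ is the minimum of $p+q$ over all ways of deleting $q$ vertices from $G$ so that the remaining induced subgraph is a vertex-disjoint union of $p$ paths (i.e. it has exactly $p$ connected components, each a path; a single vertex counts as a path). *)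

theory Defs
  imports
    "Graph_Theory.Digraph_Component"
    "Graph_Theory.Digraph_Isomorphism"
    "Graph_Theory.Pair_Digraph"
    "Jordan_Normal_Form.Char_Poly"
begin

text \<open>
  Finite simple graphs are the library's \<^locale>\<open>graph\<close>: finite symmetric digraphs without
  loops and parallel arcs (the null graph is allowed).  An undirected edge is a pair of opposite
  arcs, and the connected components are the strongly connected components \<^const>\<open>pre_digraph.sccs\<close>.
\<close>

definition matrix_graph :: "real mat \<Rightarrow> nat pair_pre_digraph" where
  "matrix_graph A = \<lparr> pverts = {0..<dim_row A},
     parcs = {(i, j). i < dim_row A \<and> j < dim_row A \<and> i \<noteq> j \<and> A $$ (i, j) \<noteq> 0} \<rparr>"

text \<open>
  The vertices of \<open>G\<close> are of arbitrary type, so ``the graph of \<open>A\<close> is \<open>G\<close>'' means that it is \<open>G\<close>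
  for some numbering of the vertices of \<open>G\<close>.  Renumbering conjugates \<open>A\<close> by a permutation matrix,
  hence has no influence on eigenvalues and multiplicities.
\<close>

definition S_matrices :: "('a, 'b) pre_digraph \<Rightarrow> real mat set" where
  "S_matrices G = {A. A \<in> carrier_mat (card (verts G)) (card (verts G))
     \<and> transpose_mat A = A \<and> digraph_iso (with_proj (matrix_graph A)) G}"

definition multiplicity_of :: "real mat \<Rightarrow> real \<Rightarrow> nat" where
  "multiplicity_of A x = Polynomial.order x (char_poly A)"

text \<open>
  The set below is finite, as multiplicities are bounded by the number of vertices, so \<^const>\<open>Sup\<close>
  is a maximum.  It is empty only for the null graph, where \<^const>\<open>Sup\<close> yields \<open>0\<close>, the nullity of
  the \<open>0 \<times> 0\<close> matrix.
\<close>

definition max_mult :: "('a, 'b) pre_digraph \<Rightarrow> nat" where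
  "max_mult G = Sup {multiplicity_of A x | A x. A \<in> S_matrices G \<and> eigenvalue A x}"

definition path_graph :: "nat \<Rightarrow> nat pair_pre_digraph" where
  "path_graph k = \<lparr> pverts = {0..<k},
     parcs = {(i, j). i < k \<and> j < k \<and> (j = Suc i \<or> i = Suc j)} \<rparr>"

definition is_path :: "('a, 'b) pre_digraph \<Rightarrow> bool" where
  "is_path H \<longleftrightarrow> (\<exists>k \<ge> 1. digraph_iso (with_proj (path_graph k)) H)"

definition disjoint_paths :: "('a, 'b) pre_digraph \<Rightarrow> nat \<Rightarrow> bool" where
  "disjoint_paths H p \<longleftrightarrow> (\<forall>C \<in> pre_digraph.sccs H. is_path C) \<and> card (pre_digraph.sccs H) = p"

text \<open>
  The minimum exists, since deleting all vertices leaves a union of \<open>0\<close> paths.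
\<close>

definition Delta_plus :: "('a, 'b) pre_digraph \<Rightarrow> nat" where
  "Delta_plus G = (LEAST m. \<exists>p q Q. Q \<subseteq> verts G \<and> card Q = q
     \<and> disjoint_paths (G \<restriction> (verts G - Q)) p \<and> m = p + q)"

end

theory Submission
  imports Defs "Jordan_Normal_Form.Jordan_Normal_Form_Existence"
    "Jordan_Normal_Form.Jordan_Normal_Form_Uniqueness"
begin

text \<open>
  The proof goes through zero forcing.  Let \<open>N = A - x I\<close> for a symmetric matrix \<open>A\<close> with graph
  \<open>G\<close>, and let \<open>v\<close> be a vector with \<open>N v = 0\<close>.  If \<open>v\<close> vanishes at a vertex \<open>u\<close> and at all
  neighbours of \<open>u\<close> but one neighbour \<open>t\<close>, then row \<open>u\<close> of \<open>N v = 0\<close> has at most the one nonzero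
  term \<open>a\<^bsub>ut\<^esub> v\<^bsub>t\<^esub>\<close>, and as \<open>a\<^bsub>ut\<^esub>\<close> is not zero, \<open>v\<close> vanishes at \<open>t\<close> as well.  So the zero set of
  \<open>v\<close> is closed under the colour change rule of zero forcing.  If \<open>Z\<close> is a set of vertices from
  which this rule reaches the whole graph, then only the zero vector of the kernel vanishes on
  \<open>Z\<close>, hence the kernel has dimension at most the size of \<open>Z\<close>
  (\<open>multiplicity_le_card_zero_forcing_set\<close>).

  If deleting \<open>Q\<close> leaves \<open>p\<close> disjoint paths, then \<open>Q\<close> together with one end of each path is such
  a set: every vertex of a path has its neighbours in \<open>Q\<close> or next to it on the same path, so each
  path is forced vertex by vertex from its chosen end (\<open>disjoint_paths_zero_forcing_set\<close>).
  That set has at most \<open>p + |Q|\<close> elements.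

  Multiplicity means the order of a root of the characteristic polynomial here, so it must
  first be identified with the dimension of the kernel of \<open>N\<close>.  That is done over the complex
  numbers, where a Jordan normal form exists: \<open>N\<close> is Hermitian, so \<open>N\<^sup>2\<close> and \<open>N\<close> have
  the same kernel, which leaves room only for Jordan blocks of size one at \<open>x\<close>
  (\<open>multiplicity_of_symmetric\<close>).
\<close>

section \<open>Multiplicities of eigenvalues of Hermitian matrices\<close>

text \<open>
  If \<open>N (N v) = 0\<close>, then the squared length of \<open>N v\<close> is the inner product of \<open>v\<close> with
  \<open>N (N v)\<close>, as \<open>N\<close> is its own adjoint; so \<open>N v = 0\<close>.
\<close>

lemma hermitian_kernel_square:
  fixes N :: "complex mat"
  assumes N: "N \<in> carrier_mat n n"
    and herm: "\<And>i j. i < n \<Longrightarrow> j < n \<Longrightarrow> N $$ (j, i) = conjugate (N $$ (i, j))"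
  shows "mat_kernel (N ^\<^sub>m 2) = mat_kernel N"
proof -
  have sq: "N ^\<^sub>m 2 = N * N" using N by (simp add: numeral_2_eq_2)
  have "N *\<^sub>v v = 0\<^sub>v n" if v: "v \<in> carrier_vec n" and NNv: "N *\<^sub>v (N *\<^sub>v v) = 0\<^sub>v n" for v
  proof -
    define w where "w = N *\<^sub>v v"
    have w: "w \<in> carrier_vec n" using N v by (simp add: w_def)
    have wi: "w $ i = (\<Sum>j<n. N $$ (i, j) * v $ j)" if "i < n" for i
      using that N v by (simp add: w_def scalar_prod_def atLeast0LessThan)
    have Nw: "(\<Sum>i<n. N $$ (j, i) * w $ i) = 0" if "j < n" for j
    proof -
      have "(N *\<^sub>v w) $ j = 0" using NNv that by (simp add: w_def)
      then show ?thesis using that N w by (simp add: scalar_prod_def atLeast0LessThan)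
    qed
    have "w \<bullet>c w = (\<Sum>i<n. w $ i * conjugate (w $ i))"
      using w by (simp add: scalar_prod_def atLeast0LessThan)
    also have "\<dots> = (\<Sum>i<n. \<Sum>j<n. v $ j * (N $$ (i, j) * conjugate (w $ i)))"
    proof (rule sum.cong[OF refl])
      fix i assume "i \<in> {..<n}"
      then have "w $ i * conjugate (w $ i) = (\<Sum>j<n. N $$ (i, j) * v $ j) * conjugate (w $ i)"
        using wi[of i] by simp
      then show "w $ i * conjugate (w $ i) = (\<Sum>j<n. v $ j * (N $$ (i, j) * conjugate (w $ i)))"
        by (simp only: sum_distrib_right sum_distrib_left mult_ac)
    qed
    also have "\<dots> = (\<Sum>j<n. \<Sum>i<n. v $ j * (N $$ (i, j) * conjugate (w $ i)))"
      by (rule sum.swap)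
    also have "\<dots> = (\<Sum>j<n. v $ j * conjugate (\<Sum>i<n. N $$ (j, i) * w $ i))"
    proof (rule sum.cong[OF refl])
      fix j assume j: "j \<in> {..<n}"
      have "(\<Sum>i<n. N $$ (i, j) * conjugate (w $ i))
          = (\<Sum>i<n. conjugate (N $$ (j, i)) * conjugate (w $ i))"
        using j herm[of j] by (intro sum.cong refl) auto
      also have "\<dots> = conjugate (\<Sum>i<n. N $$ (j, i) * w $ i)" by simp
      finally show "(\<Sum>i<n. v $ j * (N $$ (i, j) * conjugate (w $ i)))
          = v $ j * conjugate (\<Sum>i<n. N $$ (j, i) * w $ i)"
        by (simp only: sum_distrib_left[symmetric])
    qed
    also have "\<dots> = 0" by (simp add: Nw)
    finally show ?thesis using w by (simp add: w_def)
  qed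
  moreover have "N *\<^sub>v (0\<^sub>v n) = 0\<^sub>v n" using N by auto
  ultimately show ?thesis
    using N by (auto simp: mat_kernel[of _ n n] sq assoc_mult_mat_vec[of N n n N n])
qed

text \<open>
  A Jordan block of size \<open>k\<close> at \<open>x\<close> contributes \<open>k\<close> to the order of the root \<open>x\<close>, and \<open>min r k\<close>
  to the dimension of the kernel of the \<open>r\<close>-th power.  Equal kernels for \<open>r = 1\<close> and \<open>r = 2\<close>
  therefore exclude all blocks with \<open>k > 1\<close>.
\<close>

lemma order_char_poly_eq_kernel_dim:
  fixes A :: "complex mat"
  assumes A: "A \<in> carrier_mat n n"
    and ker: "mat_kernel (char_matrix A x ^\<^sub>m 2) = mat_kernel (char_matrix A x)"
  shows "Polynomial.order x (char_poly A) = kernel.dim n (char_matrix A x)"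
proof -
  from char_poly_factorized[OF A] obtain as where "char_poly A = (\<Prod>a\<leftarrow>as. [:- a, 1:])" by auto
  from jordan_nf_exists[OF A this] obtain n_as where jnf: "jordan_nf A n_as" ..
  define ks where "ks = map fst (filter (\<lambda>na. snd na = x) n_as)"
  have ks: "map fst [(n, e)\<leftarrow>n_as . e = x] = ks"
    unfolding ks_def by (simp add: case_prod_unfold)
  let ?N = "char_matrix A x"
  have N: "?N \<in> carrier_mat n n" using A by simp
  have gen: "(\<Sum>k\<leftarrow>ks. min r k) = kernel.dim n (?N ^\<^sub>m r)" for r
    using dim_gen_eigenspace[OF jnf, of x r, unfolded ks] carrier_matD(2)[OF pow_carrier_mat[OF N, of r]]
    by (simp del: pow_mat_dim add: dim_gen_eigenspace_def kernel_dim_def)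
  have one: "(\<Sum>k\<leftarrow>ks. min 1 k) = kernel.dim n ?N" using gen[of 1] N by simp
  have two: "(\<Sum>k\<leftarrow>ks. min 2 k) = kernel.dim n ?N" using gen[of 2] by (simp add: ker)
  \<comment> \<open>Comparing the two sums term by term: equality forces \<open>min 1 k = min 2 k\<close>, so \<open>k \<le> 1\<close>.\<close>
  have small: "(\<Sum>k\<leftarrow>ls. min 1 k) = sum_list ls"
    if "(\<Sum>k\<leftarrow>ls. min 1 k) = (\<Sum>k\<leftarrow>ls. min 2 k)" for ls :: "nat list"
    using that
  proof (induction ls)
    case (Cons k ls)
    have "(\<Sum>k\<leftarrow>ls. min 1 k) \<le> (\<Sum>k\<leftarrow>ls. min 2 k)" by (rule sum_list_mono) auto
    with Cons.prems have "min 1 k = min 2 k" "(\<Sum>k\<leftarrow>ls. min 1 k) = (\<Sum>k\<leftarrow>ls. min 2 k)"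
      by (auto simp: min_def split: if_splits)
    with Cons.IH show ?case by (auto simp: min_def split: if_splits)
  qed simp
  have "Polynomial.order x (char_poly A) = sum_list ks"
    unfolding ks_def by (rule jordan_nf_order[OF jnf])
  also have "\<dots> = (\<Sum>k\<leftarrow>ks. min 1 k)" using small[of ks] one two by argo
  finally show ?thesis unfolding one .
qed

lemma multiplicity_of_symmetric:
  assumes A: "A \<in> carrier_mat n n" and sym: "transpose_mat A = A"
  shows "multiplicity_of A x
    = kernel.dim n (char_matrix (map_mat complex_of_real A) (complex_of_real x))"
proof -
  let ?A = "map_mat complex_of_real A" and ?x = "complex_of_real x"
  have A': "?A \<in> carrier_mat n n" using A by simp
  have N: "char_matrix ?A ?x \<in> carrier_mat n n" using A' by simp
  have symA: "A $$ (j, i) = A $$ (i, j)" if "i < n" "j < n" for i j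
    using arg_cong[OF sym, of "\<lambda>B. B $$ (i, j)"] A that by simp
  have "mat_kernel (char_matrix ?A ?x ^\<^sub>m 2) = mat_kernel (char_matrix ?A ?x)"
  proof (rule hermitian_kernel_square[OF N])
    fix i j assume "i < n" "j < n"
    then show "char_matrix ?A ?x $$ (j, i) = conjugate (char_matrix ?A ?x $$ (i, j))"
      using A symA[of i j] by (simp add: char_matrix_def)
  qed
  note eq = order_char_poly_eq_kernel_dim[OF A' this]
  interpret of_real: map_poly_inj_idom_divide_hom complex_of_real ..
  show ?thesis
    using eq by (simp add: multiplicity_of_def of_real_hom.char_poly_hom[OF A] of_real.order_hom)
qed

text \<open>
  The restriction of kernel vectors to the coordinates in \<open>Z\<close> is injective by assumption.
  A basis of more than \<open>card Z\<close> vectors would have linearly dependent restrictions, and the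
  dependence would give a nonzero kernel vector that vanishes on \<open>Z\<close>.
\<close>

lemma kernel_dim_le_card:
  fixes N :: "'a :: field mat"
  assumes N: "N \<in> carrier_mat nr n" and Z: "Z \<subseteq> {..<n}"
    and det: "\<And>v. v \<in> mat_kernel N \<Longrightarrow> \<forall>i\<in>Z. v $ i = 0 \<Longrightarrow> v = 0\<^sub>v n"
  shows "kernel.dim n N \<le> card Z"
proof (rule ccontr)
  assume "\<not> ?thesis"
  interpret K: kernel nr n N by unfold_locales (rule N)
  obtain B where B: "finite B" "K.basis B" using kernel_basis_exists[OF N] by auto
  then have BK: "B \<subseteq> mat_kernel N" and indep: "\<not> K.lin_dep B"
    by (auto simp: K.Ker.basis_def)
  define d where "d = card B"
  have "d = K.dim" using K.Ker.dim_basis[OF B] by (simp add: d_def)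
  with \<open>\<not> ?thesis\<close> have less: "card Z < d" by simp
  obtain b where b: "bij_betw b {..<d} B"
    using ex_bij_betw_nat_finite[OF B(1)] by (auto simp: d_def atLeast0LessThan)
  have "finite Z" using Z finite_subset by blast
  then obtain z where z: "bij_betw z {..<card Z} Z"
    using ex_bij_betw_nat_finite[of Z] by (auto simp: atLeast0LessThan)
  \<comment> \<open>The restrictions of the basis vectors are the columns of \<open>M\<close>; zero rows fill it up to a
    square matrix, so that a dependence of the columns follows from a vanishing determinant.\<close>
  define M where "M = mat d d (\<lambda>(i, j). if i < card Z then b j $ z i else 0)"
  have M: "M \<in> carrier_mat d d" by (simp add: M_def)
  have "det M = (\<Sum>j<d. M $$ (card Z, j) * cofactor M (card Z) j)"
    by (rule laplace_expansion_row[OF M less])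
  also have "\<dots> = 0" using less by (simp add: M_def)
  finally have "det M = 0" .
  then obtain c where c: "c \<in> carrier_vec d" "c \<noteq> 0\<^sub>v d" "M *\<^sub>v c = 0\<^sub>v d"
    using det_0_iff_vec_prod_zero_field[OF M] by auto
  define a where "a u = c $ the_inv_into {..<d} b u" for u
  have ab: "a (b j) = c $ j" if "j < d" for j
    using that b by (simp add: a_def bij_betw_def the_inv_into_f_f)
  define v where "v = K.lincomb a B"
  have vK: "v \<in> mat_kernel N" unfolding v_def using BK K.Ker.lincomb_closed[of B a] by auto
  have vi: "v $ i = (\<Sum>j<d. c $ j * b j $ i)" if "i < n" for i
  proof -
    have "v $ i = (\<Sum>u\<in>B. a u * u $ i)"
      unfolding v_def by (rule K.lincomb_index[OF that BK])
    also have "\<dots> = (\<Sum>j<d. a (b j) * b j $ i)"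
      by (rule sum.reindex_bij_betw[OF b, symmetric])
    finally show ?thesis by (simp add: ab)
  qed
  have "v $ i = 0" if iZ: "i \<in> Z" for i
  proof -
    have "i \<in> z ` {..<card Z}" using iZ by (simp only: bij_betw_imp_surj_on[OF z])
    then obtain r where r: "r < card Z" "z r = i" by (elim imageE) simp
    have "(M *\<^sub>v c) $ r = (\<Sum>j<d. M $$ (r, j) * c $ j)"
      using r less M c(1) by (simp add: scalar_prod_def atLeast0LessThan)
    also have "\<dots> = (\<Sum>j<d. c $ j * b j $ i)"
      using r less by (intro sum.cong refl) (simp add: M_def mult.commute)
    also have "\<dots> = v $ i" using iZ Z vi[of i] by auto
    finally show ?thesis using c(3) r(1) less by simp
  qed
  with det vK have "v = 0\<^sub>v n" by blast
  moreover obtain j where j: "j < d" "c $ j \<noteq> 0" using c by (auto simp: vec_eq_iff)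
  moreover have "b j \<in> B" using b j by (auto simp: bij_betw_def)
  ultimately have "K.lin_dep B"
    unfolding K.Ker.lin_dep_def using B(1) ab[of j]
    by (intro exI[of _ B] exI[of _ a] exI[of _ "b j"]) (auto simp: v_def)
  with indep show False ..
qed

section \<open>Zero forcing\<close>

text \<open>
  The colour change rule of zero forcing: a vertex in \<open>S\<close> all of whose neighbours but \<open>t\<close> are in
  \<open>S\<close> forces \<open>t\<close> into \<open>S\<close>.
\<close>

definition forcing_closed :: "('a, 'b) pre_digraph \<Rightarrow> 'a set \<Rightarrow> bool" where
  "forcing_closed G S \<longleftrightarrow> (\<forall>u\<in>S. \<forall>t. u \<rightarrow>\<^bsub>G\<^esub> t \<longrightarrow> (\<forall>s. u \<rightarrow>\<^bsub>G\<^esub> s \<longrightarrow> s \<noteq> t \<longrightarrow> s \<in> S) \<longrightarrow> t \<in> S)"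

text \<open>
  Iterating the rule from \<open>Z\<close> ends in the least closed set that contains \<open>Z\<close>.  Demanding that all
  closed sets above \<open>Z\<close> be the full vertex set says that this iteration reaches every vertex,
  without formalizing the iteration.
\<close>

definition zero_forcing_set :: "('a, 'b) pre_digraph \<Rightarrow> 'a set \<Rightarrow> bool" where
  "zero_forcing_set G Z \<longleftrightarrow> Z \<subseteq> verts G \<and>
     (\<forall>S. Z \<subseteq> S \<longrightarrow> S \<subseteq> verts G \<longrightarrow> forcing_closed G S \<longrightarrow> S = verts G)"

lemma digraph_iso_with_projE:
  assumes "digraph_iso (with_proj P) H"
  obtains f where "bij_betw f (pverts P) (verts H)"
    and "\<And>i j. i \<in> pverts P \<Longrightarrow> j \<in> pverts P \<Longrightarrow> f i \<rightarrow>\<^bsub>H\<^esub> f j \<longleftrightarrow> (i, j) \<in> parcs P"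
proof -
  from assms obtain h where h: "pre_digraph.digraph_isomorphism (with_proj P) h"
    and H: "H = app_iso h (with_proj P)" by (auto simp: digraph_iso_def)
  from h have inj: "inj_on (iso_verts h) (pverts P)"
    and wf: "wf_digraph (with_proj P)"
    and ends: "\<And>a. a \<in> parcs P \<Longrightarrow> iso_tail h (iso_arcs h a) = iso_verts h (fst a)
       \<and> iso_head h (iso_arcs h a) = iso_verts h (snd a)"
    by (auto simp: pre_digraph.digraph_isomorphism_def)
  have pv: "fst a \<in> pverts P \<and> snd a \<in> pverts P" if "a \<in> parcs P" for a
    using wf_digraph.tail_in_verts[OF wf, of a] wf_digraph.head_in_verts[OF wf, of a] that by simp
  have "bij_betw (iso_verts h) (pverts P) (verts H)"
    using inj by (simp add: bij_betw_def H)
  moreover have "iso_verts h i \<rightarrow>\<^bsub>H\<^esub> iso_verts h j \<longleftrightarrow> (i, j) \<in> parcs P"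
    if ij: "i \<in> pverts P" "j \<in> pverts P" for i j
  proof
    assume "iso_verts h i \<rightarrow>\<^bsub>H\<^esub> iso_verts h j"
    then obtain a where a: "a \<in> parcs P" "iso_verts h (fst a) = iso_verts h i"
      "iso_verts h (snd a) = iso_verts h j"
      using ends by (auto simp: H arcs_ends_def arc_to_ends_def)
    then have "a = (i, j)" using inj pv[of a] ij by (auto simp: inj_on_def prod_eq_iff)
    with a show "(i, j) \<in> parcs P" by simp
  next
    assume "(i, j) \<in> parcs P"
    then show "iso_verts h i \<rightarrow>\<^bsub>H\<^esub> iso_verts h j"
      using ends[of "(i, j)"]
      by (auto simp: H arcs_ends_def arc_to_ends_def intro!: rev_image_eqI[of "iso_arcs h (i, j)"])
  qed
  ultimately show ?thesis by (rule that)
qed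

text \<open>
  The zero set of a kernel vector is closed under forcing, because the row of a vanishing vertex
  determines the value at its last neighbour.  So a kernel vector that vanishes on a zero forcing
  set is zero.
\<close>

lemma multiplicity_le_card_zero_forcing_set:
  assumes G: "wf_digraph G" and A: "A \<in> S_matrices G" and Z: "zero_forcing_set G Z"
  shows "multiplicity_of A x \<le> card Z"
proof -
  define n where "n = card (verts G)"
  have carr: "A \<in> carrier_mat n n" and sym: "transpose_mat A = A"
    and iso: "digraph_iso (with_proj (matrix_graph A)) G"
    using A by (auto simp: S_matrices_def n_def)
  obtain f where f: "bij_betw f {..<n} (verts G)"
    and adj: "\<And>i j. i < n \<Longrightarrow> j < n \<Longrightarrow> f i \<rightarrow>\<^bsub>G\<^esub> f j \<longleftrightarrow> i \<noteq> j \<and> A $$ (i, j) \<noteq> 0"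
    using digraph_iso_with_projE[OF iso] carr
    by (auto simp: matrix_graph_def atLeast0LessThan)
  define N where "N = char_matrix (map_mat complex_of_real A) (complex_of_real x)"
  have N: "N \<in> carrier_mat n n" using carr by (simp add: N_def)
  have Nij: "N $$ (i, j) = complex_of_real (A $$ (i, j))" if "i < n" "j < n" "i \<noteq> j" for i j
    using that carr by (simp add: N_def char_matrix_def)
  define Z' where "Z' = {i. i < n \<and> f i \<in> Z}"
  have ZV: "Z \<subseteq> verts G" using Z by (simp add: zero_forcing_set_def)
  have "bij_betw f Z' Z"
    using f ZV by (auto simp: bij_betw_def Z'_def inj_on_def image_iff subset_iff)
  then have card: "card Z' = card Z" by (rule bij_betw_same_card)
  have "kernel.dim n N \<le> card Z'"
  proof (rule kernel_dim_le_card[OF N])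
    show "Z' \<subseteq> {..<n}" by (auto simp: Z'_def)
    fix v assume v: "v \<in> mat_kernel N" and vZ: "\<forall>i\<in>Z'. v $ i = 0"
    have vc: "v \<in> carrier_vec n" and Nv: "N *\<^sub>v v = 0\<^sub>v n" using mat_kernelD[OF N v] by auto
    have eq: "(\<Sum>j<n. N $$ (i, j) * v $ j) = 0" if "i < n" for i
    proof -
      have "(N *\<^sub>v v) $ i = 0" using Nv that by simp
      then show ?thesis using that N vc by (simp add: scalar_prod_def atLeast0LessThan)
    qed
    define S where "S = f ` {i. i < n \<and> v $ i = 0}"
    have inS: "f i \<in> S \<longleftrightarrow> v $ i = 0" if "i < n" for i
      using f that by (auto simp: S_def bij_betw_def inj_on_def)
    have SV: "S \<subseteq> verts G" using f by (auto simp: S_def bij_betw_def)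
    have "forcing_closed G S"
      unfolding forcing_closed_def
    proof (intro ballI allI impI)
      fix u t assume u: "u \<in> S" and ut: "u \<rightarrow>\<^bsub>G\<^esub> t"
        and others: "\<forall>s. u \<rightarrow>\<^bsub>G\<^esub> s \<longrightarrow> s \<noteq> t \<longrightarrow> s \<in> S"
      obtain i where i: "i < n" "u = f i" "v $ i = 0" using u by (auto simp: S_def)
      have "t \<in> verts G"
        using ut by (rule wf_digraph.adj_in_verts(2)[OF G])
      then obtain k where k: "k < n" "t = f k" using f by (auto simp: bij_betw_def)
      have ik: "i \<noteq> k" "A $$ (i, k) \<noteq> 0" using adj[of i k] ut i k by auto
      have zero: "N $$ (i, j) * v $ j = 0" if j: "j < n" "j \<noteq> k" for j
      proof (cases "f i \<rightarrow>\<^bsub>G\<^esub> f j")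
        case True
        have "f j \<noteq> t" using f j k by (auto simp: bij_betw_def inj_on_def)
        with others True i have "f j \<in> S" by auto
        then show ?thesis using inS j by simp
      next
        case False
        then show ?thesis using adj[of i j] i j Nij[of i j] by (cases "i = j") auto
      qed
      have "0 = (\<Sum>j<n. N $$ (i, j) * v $ j)" using eq i by simp
      also have "\<dots> = N $$ (i, k) * v $ k"
        using k by (subst sum.remove[of _ k]) (auto intro!: sum.neutral zero simp del: mult_eq_0_iff)
      finally have "v $ k = 0" using ik Nij[of i k] i k by simp
      then show "t \<in> S" using inS k by simp
    qed
    moreover have "Z \<subseteq> S"
    proof
      fix y assume y: "y \<in> Z"
      then obtain i where "i < n" "y = f i" using ZV f by (auto simp: bij_betw_def)
      then show "y \<in> S" using y vZ inS by (auto simp: Z'_def)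
    qed
    ultimately have "S = verts G" using Z SV by (auto simp: zero_forcing_set_def)
    then show "v = 0\<^sub>v n" using vc inS f by (intro eq_vecI) (auto simp: bij_betw_def)
  qed
  then show ?thesis using multiplicity_of_symmetric[OF carr sym, of x] card by (simp add: N_def)
qed

section \<open>Forcing along disjoint paths\<close>

text \<open>
  The first \<open>m\<close> vertices of the path force the next one: the other neighbour of the last of them
  on the path precedes it, and its neighbours off the path lie in \<open>S\<close> already.
\<close>

lemma path_forced_from_end:
  assumes f: "bij_betw f {..<k} C"
    and adj: "\<And>i j. i < k \<Longrightarrow> j < k \<Longrightarrow> f i \<rightarrow>\<^bsub>G\<^esub> f j \<longleftrightarrow> j = Suc i \<or> i = Suc j"
    and out: "\<And>u t. u \<in> C \<Longrightarrow> u \<rightarrow>\<^bsub>G\<^esub> t \<Longrightarrow> t \<notin> C \<Longrightarrow> t \<in> S"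
    and S: "forcing_closed G S" and start: "f 0 \<in> S"
  shows "C \<subseteq> S"
proof -
  have "f m \<in> S" if "m < k" for m
    using that
  proof (induction m rule: less_induct)
    case (less m)
    show ?case
    proof (cases m)
      case 0
      then show ?thesis using start by simp
    next
      case (Suc l)
      have "f l \<in> S" using less Suc by simp
      moreover have "f l \<rightarrow>\<^bsub>G\<^esub> f m" using adj[of l m] less.prems Suc by simp
      moreover have "s \<in> S" if s: "f l \<rightarrow>\<^bsub>G\<^esub> s" "s \<noteq> f m" for s
      proof (cases "s \<in> C")
        case True
        then obtain j where j: "j < k" "s = f j" using f by (auto simp: bij_betw_def)
        with s adj[of l j] less.prems Suc have "j < m" by auto
        with less.IH j show ?thesis by simp
      next
        case False
        moreover have "f l \<in> C" using f less.prems Suc by (auto simp: bij_betw_def)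
        ultimately show ?thesis using out s by blast
      qed
      ultimately show ?thesis using S unfolding forcing_closed_def by blast
    qed
  qed
  then show ?thesis using f by (auto simp: bij_betw_def)
qed

text \<open>
  The witness is \<open>Q\<close> together with the first vertex of each path.  With \<open>Q\<close> in the closed set,
  the neighbours of a path vertex off its own path are there already, which is what forcing along
  the path requires.
\<close>

lemma disjoint_paths_zero_forcing_set:
  assumes G: "graph G" and Q: "Q \<subseteq> verts G"
    and paths: "disjoint_paths (G \<restriction> (verts G - Q)) p"
  obtains Z where "zero_forcing_set G Z" "card Z \<le> p + card Q"
proof -
  interpret G: graph G by (rule G)
  define H where "H = G \<restriction> (verts G - Q)"
  have HV: "verts H = verts G - Q" by (simp add: H_def)
  have Hadj: "u \<rightarrow>\<^bsub>H\<^esub> t \<longleftrightarrow> u \<rightarrow>\<^bsub>G\<^esub> t \<and> u \<notin> Q \<and> t \<notin> Q" for u t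
    by (auto simp: H_def arcs_ends_def arc_to_ends_def image_iff)
  interpret H: fin_digraph H
    unfolding H_def using G.wellformed_induce_subgraph
    by (rule wf_digraph.fin_digraphI) (simp_all add: induce_subgraph_def)
  have fin: "finite (H.sccs)"
    using H.finite_sccs_verts H.sccs_verts_conv H.inj_on_verts_sccs finite_imageD by metis
  have "\<exists>f k. bij_betw f {..<k} (verts C) \<and> 0 < k \<and>
     (\<forall>i<k. \<forall>j<k. f i \<rightarrow>\<^bsub>C\<^esub> f j \<longleftrightarrow> j = Suc i \<or> i = Suc j)" if "C \<in> H.sccs" for C
  proof -
    obtain k where "k \<ge> 1" "digraph_iso (with_proj (path_graph k)) C"
      using paths \<open>C \<in> H.sccs\<close> by (auto simp: disjoint_paths_def is_path_def H_def)
    then show ?thesis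
      by (elim digraph_iso_with_projE)
        (auto simp: path_graph_def atLeast0LessThan intro!: exI[of _ k])
  qed
  then obtain f k where f: "\<And>C. C \<in> H.sccs \<Longrightarrow> bij_betw (f C) {..<k C} (verts C)"
    and k: "\<And>C. C \<in> H.sccs \<Longrightarrow> 0 < k C"
    and adj: "\<And>C i j. C \<in> H.sccs \<Longrightarrow> i < k C \<Longrightarrow> j < k C
        \<Longrightarrow> f C i \<rightarrow>\<^bsub>C\<^esub> f C j \<longleftrightarrow> j = Suc i \<or> i = Suc j"
    by metis
  define Z where "Z = Q \<union> (\<lambda>C. f C 0) ` H.sccs"
  have CV: "verts C \<subseteq> verts H" if "C \<in> H.sccs" for C
    using that by (auto dest!: H.in_sccs_imp_induced simp: induced_subgraph_def subgraph_def)
  have fC: "f C i \<in> verts C" if "C \<in> H.sccs" "i < k C" for C i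
    using f[OF that(1)] that(2) by (auto simp: bij_betw_def)
  have "zero_forcing_set G Z"
    unfolding zero_forcing_set_def
  proof (intro conjI allI impI)
    show "Z \<subseteq> verts G" using Q fC k CV HV unfolding Z_def by blast
    fix S assume ZS: "Z \<subseteq> S" and SV: "S \<subseteq> verts G" and S: "forcing_closed G S"
    have "verts C \<subseteq> S" if C: "C \<in> H.sccs" for C
    proof (rule path_forced_from_end[OF f[OF C] _ _ S])
      have Cadj: "u \<rightarrow>\<^bsub>C\<^esub> t \<longleftrightarrow> u \<rightarrow>\<^bsub>H\<^esub> t" if "u \<in> verts C" "t \<in> verts C" for u t
        using that H.in_sccs_imp_induced[OF C]
        by (auto simp: induced_subgraph_def subgraph_def compatible_def arcs_ends_def
            arc_to_ends_def image_iff)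
      show "f C i \<rightarrow>\<^bsub>G\<^esub> f C j \<longleftrightarrow> j = Suc i \<or> i = Suc j" if "i < k C" "j < k C" for i j
        using adj[OF C that] Cadj[OF fC[OF C that(1)] fC[OF C that(2)]] Hadj
          fC[OF C that(1)] fC[OF C that(2)] CV[OF C] HV by auto
      show "f C 0 \<in> S" using ZS C by (auto simp: Z_def)
      show "t \<in> S" if u: "u \<in> verts C" and ut: "u \<rightarrow>\<^bsub>G\<^esub> t" and t: "t \<notin> verts C" for u t
      proof (rule ccontr)
        \<comment> \<open>A neighbour outside of \<open>Q\<close> would belong to the same component.\<close>
        assume "t \<notin> S"
        then have "t \<notin> Q" using ZS by (auto simp: Z_def)
        moreover have "t \<rightarrow>\<^bsub>G\<^esub> u" using ut G.graph_symmetric by blast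
        moreover have "u \<notin> Q" using u CV[OF C] HV by auto
        ultimately have "u \<rightarrow>\<^bsub>H\<^esub> t" "t \<rightarrow>\<^bsub>H\<^esub> u" using ut Hadj by auto
        then have "u \<rightarrow>\<^sup>*\<^bsub>H\<^esub> t" "t \<rightarrow>\<^sup>*\<^bsub>H\<^esub> u" by auto
        moreover have "verts C \<in> H.sccs_verts" using C by (auto simp: H.sccs_verts_conv)
        ultimately show False using u t by (auto simp: H.in_sccs_verts_conv_reachable)
      qed
    qed
    moreover have "\<exists>C\<in>H.sccs. u \<in> verts C" if "u \<in> verts H" for u
      using H.scc_of_in_sccs_verts[OF that] H.in_scc_of_self[OF that]
      by (auto simp: H.sccs_verts_conv)
    moreover have "Q \<subseteq> S" using ZS by (simp add: Z_def)
    ultimately show "S = verts G" using SV HV by blast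
  qed
  moreover have "card Z \<le> p + card Q"
  proof -
    have "card ((\<lambda>C. f C 0) ` H.sccs) \<le> p"
      using card_image_le[OF fin, of "\<lambda>C. f C 0"] paths by (simp add: disjoint_paths_def H_def)
    then show ?thesis using card_Un_le[of Q "(\<lambda>C. f C 0) ` H.sccs"] by (simp add: Z_def)
  qed
  ultimately show ?thesis by (rule that)
qed

lemma Delta_plus_attained:
  fixes G :: "('a, 'b) pre_digraph"
  obtains p Q where "Q \<subseteq> verts G" "disjoint_paths (G \<restriction> (verts G - Q)) p"
    "Delta_plus G = p + card Q"
proof -
  let ?P = "\<lambda>m. \<exists>p q Q. Q \<subseteq> verts G \<and> card Q = q
     \<and> disjoint_paths (G \<restriction> (verts G - Q)) p \<and> m = p + q"
  \<comment> \<open>Deleting every vertex is one admissible choice.\<close>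
  have "pre_digraph.sccs (G \<restriction> {}) = {}"
    by (auto simp: pre_digraph.sccs_def strongly_connected_def induced_subgraph_def subgraph_def)
  then have "disjoint_paths (G \<restriction> (verts G - verts G)) 0" by (simp add: disjoint_paths_def)
  then have "?P (0 + card (verts G))" by blast
  then have "?P (Delta_plus G)" unfolding Delta_plus_def by (rule LeastI)
  then show ?thesis using that by blast
qed

theorem theorem2p7:
  fixes G :: "('a, 'b) pre_digraph"
  assumes "graph G"
  shows "max_mult G \<le> Delta_plus G"
proof -
  obtain p Q where Q: "Q \<subseteq> verts G" "disjoint_paths (G \<restriction> (verts G - Q)) p"
    and D: "Delta_plus G = p + card Q" by (rule Delta_plus_attained)
  obtain Z where Z: "zero_forcing_set G Z" "card Z \<le> p + card Q"
    using disjoint_paths_zero_forcing_set[OF assms Q] .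
  have wf: "wf_digraph G"
    using assms by (simp add: graph_def digraph_def fin_digraph_def)
  let ?M = "{multiplicity_of A x | A x. A \<in> S_matrices G \<and> eigenvalue A x}"
  have "m \<le> Delta_plus G" if "m \<in> ?M" for m
    using that multiplicity_le_card_zero_forcing_set[OF wf _ Z(1)] Z(2) D by (auto intro: order_trans)
  \<comment> \<open>For the null graph the supremum is that of the empty set, which is \<open>0\<close>.\<close>
  then show ?thesis
    unfolding max_mult_def by (cases "?M = {}") (auto intro!: cSup_least simp del: Collect_empty_eq)
qed

end
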